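(* Let $(U^j)_{j\ge 0}$ be a solution of the implicit scheme that blows up at time $T_{h,\lambda}$. Then $$\max_{1 \le i \le N} u_i^j \sim (T_{h,\lambda} - t^j)^{-1/(p-1)} .$$ Moreover, $$\lim _{j \to \infty} \max_{1 \le i \le N} u_i^j\, (T_{h,\lambda} - t^j)^{1/(p-1)} = C_p = \left ( \frac{1}{p-1}\right )^{1/(p-1)} .$$
   Context: Let $N\ge 1$ be an integer and $p>1$ a real number. $M=\mathrm{diag}(m_1,\dots,m_N)$ is a diagonal matrix with $m_k>0$ for all $k$. $A=(a_{ik})$ is a real symmetric positive semidefinite $N\times N$ matrix with $a_{ik}\le 0$ for $i\neq k$, $a_{ii}>0$, and $\sum_{k=1}^N a_{ik}\ge 0$ for every $i$. All operations between vectors of $\mathbb{R}^N$ (in particular powers) are understood coordinate by coordinate. Implicit scheme: fix $\lambda>0$ and an initial vector $U^0\in\mathbb{R}^N$ with nonnegative entries, not all zero. For $j\ge 0$ write $U^j=(u_1^j,\dots,u_N^j)$, $w^j=\sum_{k=1}^N m_k u_k^j$, $\tau_j=\lambda/(w^j)^p$, $t^0=0$, $t^{j+1}=t^j+\tau_j$, and $$M U^{j+1}= M U^j + \tau_j \left (- AU^{j+1} + M (U^j)^p\right ).$$ The solutions considered have nonnegative entries with $w^j>0$ for all $j$. A solution blows up if $\lim_{j\to\infty}\|U^j\|_\infty=\infty$ and $T_{h,\lambda}:=\sum_{j=0}^\infty \tau_j<\infty$; $T_{h,\lambda}$ is its blow-up time (the indices $h,\lambda$ only record the dependence on the discretization).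 The notation $f(j)\sim g(j)$ means that there are constants $c,C>0$ independent of $j$ with $c\,g(j)\le f(j)\le C\,g(j)$; the constants may depend on all other data. *)

theory Defs
  imports "HOL-Analysis.Analysis"
begin

definition diag :: "real ^ 'n \<Rightarrow> real ^ 'n ^ 'n" where
  "diag m = (\<chi> i k. if i = k then m $ i else 0)"

definition psd :: "real ^ 'n ^ 'n \<Rightarrow> bool" where
  "psd A \<longleftrightarrow> transpose A = A \<and> (\<forall>x. 0 \<le> x \<bullet> (A *v x))"

text \<open>Coordinatewise power. It is only applied to vectors with nonnegative entries and to
  exponents \<open>p > 1\<close>, where \<open>0 powr p = 0\<close> is the intended value.\<close>

definition vec_powr :: "real ^ 'n \<Rightarrow> real \<Rightarrow> real ^ 'n" where
  "vec_powr u p = (\<chi> i. (u $ i) powr p)"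

definition mass :: "real ^ 'n \<Rightarrow> (nat \<Rightarrow> real ^ 'n) \<Rightarrow> nat \<Rightarrow> real" where
  "mass m U j = (\<Sum>k\<in>UNIV. m $ k * U j $ k)"

definition step :: "real ^ 'n \<Rightarrow> real \<Rightarrow> real \<Rightarrow> (nat \<Rightarrow> real ^ 'n) \<Rightarrow> nat \<Rightarrow> real" where
  "step m p l U j = l / (mass m U j) powr p"

primrec time :: "real ^ 'n \<Rightarrow> real \<Rightarrow> real \<Rightarrow> (nat \<Rightarrow> real ^ 'n) \<Rightarrow> nat \<Rightarrow> real" where
  "time m p l U 0 = 0"
| "time m p l U (Suc j) = time m p l U j + step m p l U j"

definition implicit_solution ::
  "real ^ 'n \<Rightarrow> real ^ 'n ^ 'n \<Rightarrow> real \<Rightarrow> real \<Rightarrow> (nat \<Rightarrow> real ^ 'n) \<Rightarrow> bool" where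
  "implicit_solution m A p l U \<longleftrightarrow>
     U 0 \<noteq> 0 \<and>
     (\<forall>j i. 0 \<le> U j $ i) \<and>
     (\<forall>j. 0 < mass m U j) \<and>
     (\<forall>j. diag m *v U (Suc j) =
          diag m *v U j
          + step m p l U j *\<^sub>R (- (A *v U (Suc j)) + diag m *v vec_powr (U j) p))"

definition blows_up_at ::
  "real ^ 'n \<Rightarrow> real \<Rightarrow> real \<Rightarrow> (nat \<Rightarrow> real ^ 'n) \<Rightarrow> real \<Rightarrow> bool" where
  "blows_up_at m p l U T \<longleftrightarrow>
     filterlim (\<lambda>j. infnorm (U j)) at_top sequentially \<and> step m p l U sums T"

definition max_entry :: "real ^ 'n \<Rightarrow> real" where
  "max_entry u = Max (range (\<lambda>i. u $ i))"

text \<open>Two-sided comparability at every index, not only eventually.\<close>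

definition comparable :: "(nat \<Rightarrow> real) \<Rightarrow> (nat \<Rightarrow> real) \<Rightarrow> bool" where
  "comparable f g \<longleftrightarrow> (\<exists>c>0. \<exists>C>0. \<forall>j. c * g j \<le> f j \<and> f j \<le> C * g j)"

end

theory Submission
  imports Defs
begin

text \<open>
  Write \<open>x j\<close> for the largest entry of \<open>U j\<close> and \<open>\<tau> j\<close> for the time step. The scheme forces the
  scalar sequence \<open>x\<close> to follow the explicit Euler recursion for \<open>x' = x\<^sup>p\<close> up to a relative error
  that vanishes. From above this is a discrete maximum principle: at an index where \<open>U (j + 1)\<close> is
  maximal the sign conditions on \<open>A\<close> make the diffusion term nonpositive, so
  \<open>x (j + 1) \<le> x j + \<tau> j (x j)\<^sup>p\<close> (\<open>max_entry_step_upper\<close>). From below, at an index where \<open>U j\<close> is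
  maximal, only the diagonal of \<open>A\<close> can decrease the solution, so
  \<open>(1 + b \<tau> j) x (j + 1) \<ge> x j + \<tau> j (x j)\<^sup>p\<close> with a constant \<open>b\<close> (\<open>max_entry_step_lower\<close>).
  The choice of the time step makes \<open>\<tau> j (x j)\<^sup>p\<close> bounded. As \<open>x\<close> tends to infinity, \<open>\<tau>\<close> tends to
  zero and the two bounds give \<open>(x (j + 1) - x j) / (\<tau> j (x j)\<^sup>p) \<longlonglongrightarrow> 1\<close>.

  The rest concerns one real sequence (\<open>euler_blow_up_rate\<close>). Boundedness of \<open>\<tau> j (x j)\<^sup>p\<close> yields
  \<open>x (j + 1) / x j \<longlonglongrightarrow> 1\<close>, so the decrements of \<open>y = x\<^bsup>1 - p\<^esup>\<close>, which equals \<open>(p - 1) (T - t)\<close> for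
  the differential equation, satisfy \<open>(y j - y (j + 1)) / \<tau> j \<longlonglongrightarrow> p - 1\<close>. Both \<open>y j\<close> and the
  remaining time \<open>T - t j\<close> tend to zero, and the latter has decrements \<open>\<tau> j\<close>; the Stolz-Cesaro
  theorem (\<open>stolz_cesaro_zero\<close>) therefore gives \<open>y j / (T - t j) \<longlonglongrightarrow> p - 1\<close>, which is the claimed
  limit. The two-sided bound at every index follows, because a positive sequence with a positive
  limit is bounded and bounded away from zero.
\<close>

section \<open>Limits of real sequences\<close>

text \<open>One half of the \<open>0 / 0\<close> form of the Stolz-Cesaro theorem: under the hypothesis \<open>y - a s\<close> is
  eventually increasing, and its limit is zero, so it is eventually nonpositive.\<close>

lemma stolz_cesaro_zero_upper:
  fixes y s :: "nat \<Rightarrow> real"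
  assumes "y \<longlonglongrightarrow> 0" "s \<longlonglongrightarrow> 0"
    and ev: "\<forall>\<^sub>F j in sequentially. y j - y (Suc j) \<le> a * (s j - s (Suc j))"
  shows "\<forall>\<^sub>F j in sequentially. y j \<le> a * s j"
proof -
  define z where "z j = y j - a * s j" for j
  obtain J where J: "\<And>j. j \<ge> J \<Longrightarrow> z j \<le> z (Suc j)"
    using ev unfolding eventually_sequentially z_def by (force simp: algebra_simps)
  have "z \<longlonglongrightarrow> 0 - a * 0"
    unfolding z_def by (intro tendsto_intros assms)
  then have lim: "(\<lambda>j. z (j + J)) \<longlonglongrightarrow> 0"
    using LIMSEQ_ignore_initial_segment[of z 0 J] by simp
  have "incseq (\<lambda>j. z (j + J))"
    by (rule incseq_SucI) (use J in simp)
  then have "z (j + J) \<le> 0" for j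
    using incseq_le lim by blast
  then have "z j \<le> 0" if "j \<ge> J" for j
    using that by (metis le_add_diff_inverse2)
  then show ?thesis
    unfolding eventually_sequentially z_def by force
qed

text \<open>The one-sided comparison yields a weak inequality, whereas convergence asks for strict ones;
  an intermediate value \<open>a'\<close> closes this gap. The lower bound is the upper bound for \<open>- y\<close>.\<close>

lemma stolz_cesaro_zero:
  fixes y s :: "nat \<Rightarrow> real"
  assumes y: "y \<longlonglongrightarrow> 0" and s: "s \<longlonglongrightarrow> 0"
    and dec: "\<And>j. s (Suc j) < s j" and pos: "\<And>j. 0 < s j"
    and lim: "(\<lambda>j. (y j - y (Suc j)) / (s j - s (Suc j))) \<longlonglongrightarrow> L"
  shows "(\<lambda>j. y j / s j) \<longlonglongrightarrow> L"
proof (rule order_tendstoI)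
  fix a assume "a < L"
  then obtain a' where a': "a < a'" "a' < L" using dense by blast
  have "\<forall>\<^sub>F j in sequentially. - y j - - y (Suc j) \<le> - a' * (s j - s (Suc j))"
    using order_tendstoD(1)[OF lim a'(2)]
    by eventually_elim (use dec in \<open>simp add: field_simps\<close>)
  from stolz_cesaro_zero_upper[OF _ s this]
  have "\<forall>\<^sub>F j in sequentially. - y j \<le> - a' * s j"
    using tendsto_minus[OF y] by simp
  then show "\<forall>\<^sub>F j in sequentially. a < y j / s j"
  proof eventually_elim
    case (elim j)
    then have "a' \<le> y j / s j" using pos[of j] by (simp add: field_simps)
    then show ?case using a' by simp
  qed
next
  fix a assume "L < a"
  then obtain a' where a': "L < a'" "a' < a" using dense by blast
  have "\<forall>\<^sub>F j in sequentially. y j - y (Suc j) \<le> a' * (s j - s (Suc j))"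
    using order_tendstoD(2)[OF lim a'(1)]
    by eventually_elim (use dec in \<open>simp add: field_simps\<close>)
  from stolz_cesaro_zero_upper[OF y s this]
  show "\<forall>\<^sub>F j in sequentially. y j / s j < a"
  proof eventually_elim
    case (elim j)
    then have "y j / s j \<le> a'" using pos[of j] by (simp add: field_simps)
    then show ?case using a' by simp
  qed
qed

lemma positive_limit_bounds:
  fixes f :: "nat \<Rightarrow> real"
  assumes pos: "\<And>j. 0 < f j" and lim: "f \<longlonglongrightarrow> L" and "0 < L"
  obtains c C where "0 < c" "0 < C" "\<And>j. c \<le> f j" "\<And>j. f j \<le> C"
proof -
  have upper: "\<exists>C>0. \<forall>j. g j \<le> C" if "g \<longlonglongrightarrow> K" for g :: "nat \<Rightarrow> real" and K
    using convergent_imp_Bseq[of g] that unfolding convergent_def Bseq_def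
    by (metis abs_ge_self dual_order.trans real_norm_def)
  obtain C where C: "C > 0" "\<And>j. f j \<le> C" using upper[OF lim] by blast
  have "(\<lambda>j. inverse (f j)) \<longlonglongrightarrow> inverse L"
    using lim \<open>0 < L\<close> by (intro tendsto_intros) auto
  then obtain D where D: "D > 0" "\<And>j. inverse (f j) \<le> D" using upper by blast
  have "inverse D \<le> f j" for j
    using D(1) D(2)[of j] pos[of j] by (simp add: field_simps)
  then show thesis using that[of "inverse D" C] C D by simp
qed

section \<open>Blow-up rate of an asymptotic Euler recursion\<close>

text \<open>The substitution \<open>y = x\<^bsup>1 - p\<^esup>\<close> linearises \<open>x' = x\<^sup>p\<close>. In the discrete setting the chain rule
  is replaced by the difference quotient of \<open>q \<mapsto> q\<^bsup>1 - p\<^esup>\<close> at \<open>1\<close>, taken at the quotients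
  \<open>q j = x (j + 1) / x j\<close>; the bound \<open>K\<close> on the increments is what makes these tend to \<open>1\<close>.\<close>

lemma euler_blow_up_rate:
  fixes x \<tau> :: "nat \<Rightarrow> real"
  assumes p: "p > 1"
    and xpos: "\<And>j. 0 < x j" and \<tau>pos: "\<And>j. 0 < \<tau> j"
    and xtop: "filterlim x at_top sequentially"
    and bound: "\<And>j. \<tau> j * x j powr p \<le> K"
    and sums: "\<tau> sums T"
    and euler: "(\<lambda>j. (x (Suc j) - x j) / (\<tau> j * x j powr p)) \<longlonglongrightarrow> 1"
  shows "(\<lambda>j. x j * (T - sum \<tau> {..<j}) powr (1 / (p - 1))) \<longlonglongrightarrow> (1 / (p - 1)) powr (1 / (p - 1))"
proof -
  define r where "r j = (x (Suc j) - x j) / (\<tau> j * x j powr p)" for j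
  define q where "q j = x (Suc j) / x j" for j
  define y where "y j = x j powr (1 - p)" for j
  define s where "s j = T - sum \<tau> {..<j}" for j
  have r: "r \<longlonglongrightarrow> 1" using euler unfolding r_def .
  have xinv: "(\<lambda>j. inverse (x j)) \<longlonglongrightarrow> 0"
    using tendsto_inverse_0_at_top[OF xtop] .
  have q_eq: "q j = 1 + r j * (\<tau> j * x j powr p * inverse (x j))" for j
    using xpos[of j] \<tau>pos[of j] by (simp add: q_def r_def field_simps)
  have "(\<lambda>j. \<tau> j * x j powr p * inverse (x j)) \<longlonglongrightarrow> 0"
  proof (rule tendsto_sandwich[OF _ _ tendsto_const])
    show "(\<lambda>j. K * inverse (x j)) \<longlonglongrightarrow> 0"
      using tendsto_mult[OF tendsto_const xinv, of K] by simp
    show "\<forall>\<^sub>F j in sequentially. 0 \<le> \<tau> j * x j powr p * inverse (x j)"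
      using xpos \<tau>pos by (intro always_eventually allI) (simp add: less_imp_le)
    show "\<forall>\<^sub>F j in sequentially. \<tau> j * x j powr p * inverse (x j) \<le> K * inverse (x j)"
      using xpos bound by (intro always_eventually allI mult_right_mono) (auto simp: less_imp_le)
  qed
  from tendsto_add[OF tendsto_const tendsto_mult[OF r this], of 1]
  have q: "q \<longlonglongrightarrow> 1" by (simp add: q_eq[abs_def])
  have rpos: "\<forall>\<^sub>F j in sequentially. 0 < r j"
    using order_tendstoD(1)[OF r, of 0] by simp
  (* Eventually q j differs from 1, as the difference quotient below demands. *)
  have q_gt: "\<forall>\<^sub>F j in sequentially. 1 < q j"
    using rpos
  proof eventually_elim
    case (elim j)
    then show ?case using xpos[of j] \<tau>pos[of j] by (simp add: q_eq)
  qed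
  have q_at: "filterlim q (at 1) sequentially"
    unfolding filterlim_at using q q_gt by (auto elim: eventually_mono)
  have "((\<lambda>z::real. z powr (1 - p)) has_real_derivative (1 - p)) (at 1)"
    by (auto intro!: derivative_eq_intros)
  then have "((\<lambda>z. (z powr (1 - p) - 1) / (z - 1)) \<longlongrightarrow> 1 - p) (at (1::real))"
    by (simp add: has_field_derivative_iff)
  from filterlim_compose[OF this q_at]
  have quot: "(\<lambda>j. (q j powr (1 - p) - 1) / (q j - 1)) \<longlonglongrightarrow> 1 - p" .
  have ratio: "(\<lambda>j. (y j - y (Suc j)) / \<tau> j) \<longlonglongrightarrow> p - 1"
  proof (rule Lim_transform_eventually)
    show "(\<lambda>j. - (r j * ((q j powr (1 - p) - 1) / (q j - 1)))) \<longlonglongrightarrow> p - 1"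
      using tendsto_minus[OF tendsto_mult[OF r quot]] by simp
    show "\<forall>\<^sub>F j in sequentially.
        - (r j * ((q j powr (1 - p) - 1) / (q j - 1))) = (y j - y (Suc j)) / \<tau> j"
      using q_gt
    proof eventually_elim
      case (elim j)
      have xs: "x (Suc j) = q j * x j" using xpos[of j] by (simp add: q_def)
      have y_Suc: "y (Suc j) = q j powr (1 - p) * y j"
        unfolding y_def xs using elim xpos[of j] by (simp add: powr_mult)
      have "x j powr p * y j = x j"
        using xpos[of j] unfolding y_def by (simp add: powr_add[symmetric])
      then have r_eq: "r j = (q j - 1) * y j / \<tau> j"
        using xpos[of j] \<tau>pos[of j] unfolding r_def xs by (simp add: field_simps)
      show ?case
        unfolding r_eq y_Suc using elim \<tau>pos[of j] by (simp add: field_simps)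
    qed
  qed
  have y0: "y \<longlonglongrightarrow> 0"
    unfolding y_def using tendsto_neg_powr[OF _ xtop, of "1 - p"] p by simp
  have s0: "s \<longlonglongrightarrow> 0"
    using tendsto_diff[OF tendsto_const sums[unfolded sums_def], of T] by (simp add: s_def[abs_def])
  have s_dec: "s j - s (Suc j) = \<tau> j" for j by (simp add: s_def)
  have s_pos: "0 < s j" for j
    using sum_less_suminf[OF sums_summable[OF sums], of j] \<tau>pos sums_unique[OF sums]
    by (simp add: s_def)
  have "(\<lambda>j. y j / s j) \<longlonglongrightarrow> p - 1"
  proof (rule stolz_cesaro_zero[OF y0 s0])
    show "s (Suc j) < s j" for j using s_dec[of j] \<tau>pos[of j] by linarith
  qed (use s_pos s_dec ratio in auto)
  then have "(\<lambda>j. (y j / s j) powr (- 1 / (p - 1))) \<longlonglongrightarrow> (p - 1) powr (- 1 / (p - 1))"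
    using p by (intro tendsto_intros) auto
  moreover have "(y j / s j) powr (- 1 / (p - 1)) = x j * s j powr (1 / (p - 1))" for j
  proof -
    have "(1 - p) * (- 1 / (p - 1)) = 1" using p by (simp add: field_simps)
    then have "y j powr (- 1 / (p - 1)) = x j"
      using xpos[of j] by (simp add: y_def powr_powr del: minus_divide_left)
    moreover have "s j powr (- 1 / (p - 1)) = 1 / s j powr (1 / (p - 1))"
      using powr_minus_divide[of "s j" "1 / (p - 1)"] by simp
    moreover have "(y j / s j) powr (- 1 / (p - 1))
        = y j powr (- 1 / (p - 1)) / s j powr (- 1 / (p - 1))"
      by (rule powr_divide)
    ultimately show ?thesis by simp
  qed
  moreover have "(p - 1) powr (- 1 / (p - 1)) = (1 / (p - 1)) powr (1 / (p - 1))"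
    using p by (simp add: powr_divide powr_minus field_simps)
  ultimately show ?thesis by (simp add: s_def)
qed

section \<open>The largest entry along the implicit scheme\<close>

lemma entry_le_max_entry: "u $ i \<le> max_entry u"
  by (simp add: max_entry_def)

lemma max_entry_attained: obtains i where "max_entry u = u $ i"
proof -
  have "max_entry u \<in> range (\<lambda>i. u $ i)"
    unfolding max_entry_def by (rule Max_in) auto
  then show thesis using that by blast
qed

lemma infnorm_le_max_entry:
  fixes u :: "real ^ 'n"
  assumes "\<And>i. 0 \<le> u $ i"
  shows "infnorm u \<le> max_entry u"
proof -
  have "infnorm u = Sup {\<bar>u $ i\<bar> |i. i \<in> UNIV}" by (rule infnorm_cart)
  also have "\<dots> \<le> max_entry u"
    by (rule cSup_least) (use assms entry_le_max_entry in auto)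
  finally show ?thesis .
qed

lemma time_eq_sum: "time m p l U j = sum (step m p l U) {..<j}"
  by (induction j) auto

lemma implicit_solution_entry:
  assumes "implicit_solution m A p l U"
  shows "m $ i * U (Suc j) $ i = m $ i * U j $ i
    + step m p l U j * (m $ i * (U j $ i) powr p - (\<Sum>k\<in>UNIV. A $ i $ k * U (Suc j) $ k))"
proof -
  have diag: "(diag m *v v) $ i = m $ i * v $ i" for v
    by (simp add: diag_def matrix_vector_mult_def if_distrib[of "\<lambda>z. z * _"] cong: if_cong)
  have "(diag m *v U (Suc j)) $ i
      = (diag m *v U j + step m p l U j *\<^sub>R (- (A *v U (Suc j)) + diag m *v vec_powr (U j) p)) $ i"
    using assms unfolding implicit_solution_def by metis
  then show ?thesis
    by (simp add: diag vec_powr_def) (simp add: matrix_vector_mult_def algebra_simps)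
qed

text \<open>At an index \<open>i\<close> where \<open>u\<close> is maximal, replacing every entry by \<open>u $ i\<close> can only decrease
  \<open>(A u) $ i\<close>, and the row sum of \<open>A\<close> is nonnegative.\<close>

lemma row_nonneg_at_max:
  fixes A :: "real ^ 'n ^ 'n"
  assumes off: "\<And>k. i \<noteq> k \<Longrightarrow> A $ i $ k \<le> 0"
    and row: "(\<Sum>k\<in>UNIV. A $ i $ k) \<ge> 0"
    and max: "\<And>k. u $ k \<le> u $ i" and "0 \<le> u $ i"
  shows "0 \<le> (\<Sum>k\<in>UNIV. A $ i $ k * u $ k)"
proof -
  have "0 \<le> (\<Sum>k\<in>UNIV. A $ i $ k) * u $ i"
    using row \<open>0 \<le> u $ i\<close> by simp
  also have "\<dots> = (\<Sum>k\<in>UNIV. A $ i $ k * u $ i)" by (rule sum_distrib_right)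
  also have "\<dots> \<le> (\<Sum>k\<in>UNIV. A $ i $ k * u $ k)"
  proof (rule sum_mono)
    show "A $ i $ k * u $ i \<le> A $ i $ k * u $ k" for k
      using off[of k] max[of k] by (cases "i = k") (auto intro: mult_left_mono_neg)
  qed
  finally show ?thesis .
qed

text \<open>The discrete maximum principle: the diffusion term, being implicit, is evaluated at the new
  time, so it has a favourable sign at an index where the new vector is maximal.\<close>

lemma max_entry_step_upper:
  assumes sol: "implicit_solution m A p l U" and p: "p > 1" and l: "l > 0"
    and m: "\<And>k. m $ k > 0"
    and off: "\<And>i k. i \<noteq> k \<Longrightarrow> A $ i $ k \<le> 0"
    and row: "\<And>i. (\<Sum>k\<in>UNIV. A $ i $ k) \<ge> 0"
  shows "max_entry (U (Suc j)) \<le> max_entry (U j) + step m p l U j * max_entry (U j) powr p"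
proof -
  obtain i where i: "max_entry (U (Suc j)) = U (Suc j) $ i" by (rule max_entry_attained)
  have nonneg: "0 \<le> U n $ k" for n k using sol by (simp add: implicit_solution_def)
  have step: "0 \<le> step m p l U j" using l by (simp add: step_def)
  have "0 \<le> (\<Sum>k\<in>UNIV. A $ i $ k * U (Suc j) $ k)"
    by (rule row_nonneg_at_max) (use off row nonneg i entry_le_max_entry[of "U (Suc j)"] in auto)
  then have "step m p l U j * (m $ i * (U j $ i) powr p - (\<Sum>k\<in>UNIV. A $ i $ k * U (Suc j) $ k))
      \<le> step m p l U j * (m $ i * (U j $ i) powr p)"
    using step by (intro mult_left_mono) auto
  then have "m $ i * U (Suc j) $ i \<le> m $ i * (U j $ i + step m p l U j * (U j $ i) powr p)"
    using implicit_solution_entry[OF sol, of i j] by (simp add: algebra_simps)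
  then have "U (Suc j) $ i \<le> U j $ i + step m p l U j * (U j $ i) powr p"
    using m by simp
  also have "\<dots> \<le> max_entry (U j) + step m p l U j * max_entry (U j) powr p"
    using nonneg p step entry_le_max_entry by (intro add_mono mult_left_mono powr_mono2) auto
  finally show ?thesis using i by simp
qed

text \<open>The off-diagonal terms of \<open>A\<close> only feed mass into an entry, so an entry loses at most what
  its diagonal coefficient removes.\<close>

lemma max_entry_step_lower:
  assumes sol: "implicit_solution m A p l U" and l: "l > 0"
    and m: "\<And>k. m $ k > 0"
    and off: "\<And>i k. i \<noteq> k \<Longrightarrow> A $ i $ k \<le> 0"
    and b: "\<And>i. A $ i $ i \<le> b * m $ i" and "0 \<le> b"
  shows "max_entry (U j) + step m p l U j * max_entry (U j) powr p
    \<le> (1 + b * step m p l U j) * max_entry (U (Suc j))"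
proof -
  obtain i where i: "max_entry (U j) = U j $ i" by (rule max_entry_attained)
  have nonneg: "0 \<le> U n $ k" for n k using sol by (simp add: implicit_solution_def)
  have step: "0 \<le> step m p l U j" using l by (simp add: step_def)
  have "(\<Sum>k\<in>UNIV. A $ i $ k * U (Suc j) $ k)
      = A $ i $ i * U (Suc j) $ i + (\<Sum>k\<in>UNIV - {i}. A $ i $ k * U (Suc j) $ k)"
    by (simp add: sum.remove)
  also have "(\<Sum>k\<in>UNIV - {i}. A $ i $ k * U (Suc j) $ k) \<le> 0"
    by (rule sum_nonpos) (use off nonneg in \<open>auto intro: mult_nonpos_nonneg\<close>)
  also have "A $ i $ i * U (Suc j) $ i + 0 \<le> b * m $ i * U (Suc j) $ i"
    unfolding add_0_right using b nonneg by (intro mult_right_mono) auto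
  finally have "step m p l U j * (m $ i * (U j $ i) powr p - b * m $ i * U (Suc j) $ i)
      \<le> step m p l U j * (m $ i * (U j $ i) powr p - (\<Sum>k\<in>UNIV. A $ i $ k * U (Suc j) $ k))"
    using step by (intro mult_left_mono) auto
  then have "m $ i * (U j $ i + step m p l U j * (U j $ i) powr p)
      \<le> m $ i * ((1 + b * step m p l U j) * U (Suc j) $ i)"
    using implicit_solution_entry[OF sol, of i j]
    by (simp (no_asm_use) only: algebra_simps)
  then have "U j $ i + step m p l U j * (U j $ i) powr p \<le> (1 + b * step m p l U j) * U (Suc j) $ i"
    using m by simp
  also have "\<dots> \<le> (1 + b * step m p l U j) * max_entry (U (Suc j))"
    using step \<open>0 \<le> b\<close> entry_le_max_entry by (intro mult_left_mono) auto
  finally show ?thesis using i by simp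
qed

lemma max_entry_pos:
  assumes sol: "implicit_solution m A p l U"
  shows "0 < max_entry (U j)"
proof (rule ccontr)
  assume "\<not> 0 < max_entry (U j)"
  then have "U j $ k = 0" for k
    using sol entry_le_max_entry[of "U j" k] unfolding implicit_solution_def
    by (metis order.antisym order.trans not_less)
  then have "mass m U j = 0" by (simp add: mass_def)
  then show False using sol unfolding implicit_solution_def by (metis less_irrefl)
qed

text \<open>The time step is adapted to the nonlinearity: it compensates the growth of \<open>x\<^sup>p\<close>, because the
  mass dominates a multiple of the largest entry.\<close>

lemma step_times_powr_bounded:
  assumes sol: "implicit_solution m A p l U" and p: "p > 1" and l: "l > 0"
    and m: "\<And>k. m $ k > 0"
  obtains K where "\<And>j. step m p l U j * max_entry (U j) powr p \<le> K"
proof -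
  define c where "c = Min (range (\<lambda>k. m $ k))"
  have c: "0 < c" unfolding c_def using m by auto
  have c_le: "c \<le> m $ k" for k unfolding c_def by simp
  have nonneg: "0 \<le> U n $ k" for n k using sol by (simp add: implicit_solution_def)
  have "step m p l U j * max_entry (U j) powr p \<le> l / c powr p" for j
  proof -
    obtain i where i: "max_entry (U j) = U j $ i" by (rule max_entry_attained)
    have "c * max_entry (U j) \<le> m $ i * U j $ i"
      unfolding i using c_le nonneg by (intro mult_right_mono) auto
    also have "\<dots> \<le> mass m U j"
      unfolding mass_def
      by (rule member_le_sum) (use m nonneg in \<open>auto simp: less_imp_le\<close>)
    finally have "(c * max_entry (U j)) powr p \<le> mass m U j powr p"
      using p c max_entry_pos[OF sol, of j] by (intro powr_mono2) auto
    then have "c powr p * max_entry (U j) powr p \<le> mass m U j powr p"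
      using c max_entry_pos[OF sol, of j] by (simp add: powr_mult)
    moreover have "0 < mass m U j" using sol by (simp add: implicit_solution_def)
    ultimately show ?thesis
      using c l by (simp add: step_def field_simps)
  qed
  then show thesis by (rule that)
qed

section \<open>The blow-up rate of the implicit scheme\<close>

theorem theorem3p2:
  fixes m :: "real ^ 'n" and A :: "real ^ 'n ^ 'n" and p l T :: real
    and U :: "nat \<Rightarrow> real ^ 'n"
  assumes "p > 1" and "l > 0"
    and "\<forall>k. m $ k > 0"
    and "psd A"
    and "\<forall>i k. i \<noteq> k \<longrightarrow> A $ i $ k \<le> 0"
    and "\<forall>i. A $ i $ i > 0"
    and "\<forall>i. (\<Sum>k\<in>UNIV. A $ i $ k) \<ge> 0"
    and "implicit_solution m A p l U"
    and "blows_up_at m p l U T"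
  shows "comparable (\<lambda>j. max_entry (U j)) (\<lambda>j. (T - time m p l U j) powr (- 1 / (p - 1)))
    \<and> (\<lambda>j. max_entry (U j) * (T - time m p l U j) powr (1 / (p - 1)))
        \<longlonglongrightarrow> (1 / (p - 1)) powr (1 / (p - 1))"
proof -
  note p = assms(1) and l = assms(2) and sol = assms(8)
  have m: "\<And>k. m $ k > 0" and off: "\<And>i k. i \<noteq> k \<Longrightarrow> A $ i $ k \<le> 0"
    and row: "\<And>i. (\<Sum>k\<in>UNIV. A $ i $ k) \<ge> 0"
    using assms by auto
  define x where "x j = max_entry (U j)" for j
  define \<tau> where "\<tau> = step m p l U"
  have nonneg: "0 \<le> U n $ k" for n k using sol by (simp add: implicit_solution_def)
  have xpos: "0 < x j" for j unfolding x_def by (rule max_entry_pos[OF sol])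
  have \<tau>pos: "0 < \<tau> j" for j
  proof -
    have "0 < mass m U j" using sol by (simp add: implicit_solution_def)
    then show ?thesis using l by (simp add: \<tau>_def step_def)
  qed
  have sums: "\<tau> sums T" and norm_top: "filterlim (\<lambda>j. infnorm (U j)) at_top sequentially"
    using assms(9) by (auto simp: blows_up_at_def \<tau>_def)
  have xtop: "filterlim x at_top sequentially"
    by (rule filterlim_at_top_mono[OF norm_top])
       (simp add: x_def infnorm_le_max_entry nonneg)
  obtain K where K: "\<And>j. \<tau> j * x j powr p \<le> K"
    using step_times_powr_bounded[OF sol p l m] unfolding x_def \<tau>_def by blast
  (* Any common bound for the quotients A $ i $ i / m $ i serves as b; their sum is one. *)
  define b where "b = (\<Sum>i\<in>UNIV. A $ i $ i / m $ i)"
  have b_ge: "A $ i $ i / m $ i \<le> b" for i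
    unfolding b_def by (rule member_le_sum) (use m assms(6) in \<open>auto simp: less_imp_le\<close>)
  have b: "A $ i $ i \<le> b * m $ i" for i using b_ge[of i] m[of i] by (simp add: field_simps)
  have b0: "0 \<le> b"
    unfolding b_def using m assms(6) by (intro sum_nonneg) (auto simp: less_imp_le)
  have upper: "x (Suc j) \<le> x j + \<tau> j * x j powr p" for j
    unfolding x_def \<tau>_def by (rule max_entry_step_upper[OF sol p l m off row])
  have lower: "x j + \<tau> j * x j powr p \<le> (1 + b * \<tau> j) * x (Suc j)" for j
    unfolding x_def \<tau>_def by (rule max_entry_step_lower[OF sol l m off b b0])
  have \<tau>0: "\<tau> \<longlonglongrightarrow> 0"
    using summable_LIMSEQ_zero[OF sums_summable[OF sums]] .
  have y0: "(\<lambda>j. x j powr (1 - p)) \<longlonglongrightarrow> 0"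
    using tendsto_neg_powr[OF _ xtop, of "1 - p"] p by simp
  (* Subtracting x j from both one-step bounds and dividing by the Euler increment squeezes the
     quotient between 1 and an expression that tends to 1. *)
  have euler: "(\<lambda>j. (x (Suc j) - x j) / (\<tau> j * x j powr p)) \<longlonglongrightarrow> 1"
  proof (rule tendsto_sandwich[OF _ _ _ tendsto_const])
    (* The loss b * \<tau> j * x j, divided by the increment \<tau> j * x j powr p, is b * x j powr (1 - p). *)
    have "(\<lambda>j. (1 - b * x j powr (1 - p)) / (1 + b * \<tau> j)) \<longlonglongrightarrow> (1 - b * 0) / (1 + b * 0)"
      by (intro tendsto_intros \<tau>0 y0) simp
    then show "(\<lambda>j. (1 - b * x j powr (1 - p)) / (1 + b * \<tau> j)) \<longlonglongrightarrow> 1" by simp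
    show "\<forall>\<^sub>F j in sequentially. (x (Suc j) - x j) / (\<tau> j * x j powr p) \<le> 1"
    proof (intro always_eventually allI)
      show "(x (Suc j) - x j) / (\<tau> j * x j powr p) \<le> 1" for j
        using upper[of j] xpos[of j] \<tau>pos[of j] by simp
    qed
    show "\<forall>\<^sub>F j in sequentially.
        (1 - b * x j powr (1 - p)) / (1 + b * \<tau> j) \<le> (x (Suc j) - x j) / (\<tau> j * x j powr p)"
    proof (intro always_eventually allI)
      fix j
      define P where "P = x j powr p"
      have P: "0 < P" using xpos[of j] by (simp add: P_def)
      have "P * x j powr (1 - p) = x j"
        unfolding P_def using xpos[of j] by (simp add: powr_add[symmetric])
      then have y: "x j powr (1 - p) = x j / P" using P by (simp add: field_simps)
      have d: "0 < 1 + b * \<tau> j" using b0 \<tau>pos[of j] by (simp add: add_pos_nonneg)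
      have "(1 - b * (x j / P)) * (\<tau> j * P) = \<tau> j * P - b * \<tau> j * x j"
        using P by (simp add: field_simps)
      also have "\<dots> \<le> (x (Suc j) - x j) * (1 + b * \<tau> j)"
        using lower[of j] by (simp add: P_def algebra_simps)
      finally show "(1 - b * x j powr (1 - p)) / (1 + b * \<tau> j)
          \<le> (x (Suc j) - x j) / (\<tau> j * x j powr p)"
        unfolding y P_def[symmetric] using d P \<tau>pos[of j] by (simp add: divide_le_eq le_divide_eq)
    qed
  qed
  define s where "s j = T - time m p l U j" for j
  have s_eq: "s j = T - sum \<tau> {..<j}" for j by (simp add: s_def \<tau>_def time_eq_sum)
  have spos: "0 < s j" for j
    using sum_less_suminf[OF sums_summable[OF sums], of j] \<tau>pos sums_unique[OF sums]
    by (simp add: s_eq)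
  have lim: "(\<lambda>j. x j * s j powr (1 / (p - 1))) \<longlonglongrightarrow> (1 / (p - 1)) powr (1 / (p - 1))"
    unfolding s_eq by (rule euler_blow_up_rate[OF p xpos \<tau>pos xtop K sums euler])
  obtain c C where c: "0 < c" "0 < C"
    and bounds: "\<And>j. c \<le> x j * s j powr (1 / (p - 1))" "\<And>j. x j * s j powr (1 / (p - 1)) \<le> C"
  proof (rule positive_limit_bounds[OF _ lim])
    show "0 < x j * s j powr (1 / (p - 1))" for j using xpos[of j] spos[of j] by simp
  qed (use p in auto)
  have "c * s j powr (- 1 / (p - 1)) \<le> x j \<and> x j \<le> C * s j powr (- 1 / (p - 1))" for j
  proof -
    have "s j powr (- 1 / (p - 1)) = 1 / s j powr (1 / (p - 1))"
      using powr_minus_divide[of "s j" "1 / (p - 1)"] by simp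
    then show ?thesis
      using bounds[of j] spos[of j] by (simp add: pos_divide_le_eq pos_le_divide_eq)
  qed
  then have "comparable x (\<lambda>j. s j powr (- 1 / (p - 1)))"
    unfolding comparable_def using c by blast
  then show ?thesis using lim by (simp add: x_def[abs_def] s_def)
qed

end
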